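(* Let $V$ be a 6-dimensional real vector space and let $\omega\in U_0\subset\Lambda^3V^*$. Then there exists a tangent structure $F$ on $V$, unique up to a nonzero real multiple, such that $$\omega(Fv_1,v_2,v_3)=\omega(v_1,Fv_2,v_3)=\omega(v_1,v_2,Fv_3)$$ for all $v_1,v_2,v_3\in V$.
   Context: $V$ is a 6-dimensional real vector space. $U_0\subset\Lambda^3V^*$ is the $GL(V)$-orbit (under pullback) of the form $\omega_0=\alpha_1\wedge\alpha_4\wedge\alpha_5+\alpha_2\wedge\alpha_4\wedge\alpha_6+\alpha_3\wedge\alpha_5\wedge\alpha_6$, where $\alpha_1,\dots,\alpha_6$ is a basis of $V^*$. A tangent structure on $V$ is a linear endomorphism $F:V\to V$ with $F^2=0$ and $\operatorname{im}F=\ker F$. *)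

theory Defs
  imports "HOL-Analysis.Analysis"
begin

text \<open>A basis of the algebraic dual \<open>V\<^sup>*\<close>, given as a finite family of linear functionals.\<close>

definition is_dual_basis :: "'i set \<Rightarrow> ('i \<Rightarrow> 'v::real_vector \<Rightarrow> real) \<Rightarrow> bool" where
  "is_dual_basis I \<alpha> \<longleftrightarrow>
     finite I \<and>
     (\<forall>i\<in>I. linear (\<alpha> i)) \<and>
     (\<forall>c. (\<forall>v. (\<Sum>i\<in>I. c i * \<alpha> i v) = 0) \<longrightarrow> (\<forall>i\<in>I. c i = 0)) \<and>
     (\<forall>f. linear f \<longrightarrow> (\<exists>c. \<forall>v. f v = (\<Sum>i\<in>I. c i * \<alpha> i v)))"

definition wedge3 ::
  "('v \<Rightarrow> real) \<Rightarrow> ('v \<Rightarrow> real) \<Rightarrow> ('v \<Rightarrow> real) \<Rightarrow> 'v \<Rightarrow> 'v \<Rightarrow> 'v \<Rightarrow> real" where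
  "wedge3 a b c = (\<lambda>u v w. det (vector [vector [a u, a v, a w],
                                         vector [b u, b v, b w],
                                         vector [c u, c v, c w]] :: real^3^3))"

text \<open>Elements of \<open>\<Lambda>\<^sup>3V\<^sup>*\<close>: alternating trilinear forms.\<close>

definition alt3_forms :: "('v::real_vector \<Rightarrow> 'v \<Rightarrow> 'v \<Rightarrow> real) set" where
  "alt3_forms = {\<omega>.
     (\<forall>v w. linear (\<lambda>u. \<omega> u v w)) \<and>
     (\<forall>u w. linear (\<lambda>v. \<omega> u v w)) \<and>
     (\<forall>u v. linear (\<lambda>w. \<omega> u v w)) \<and>
     (\<forall>u v. \<omega> u u v = 0 \<and> \<omega> u v u = 0 \<and> \<omega> v u u = 0)}"

definition omega0 :: "(nat \<Rightarrow> 'v \<Rightarrow> real) \<Rightarrow> 'v \<Rightarrow> 'v \<Rightarrow> 'v \<Rightarrow> real" where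
  "omega0 \<alpha> = (\<lambda>u v w. wedge3 (\<alpha> 1) (\<alpha> 4) (\<alpha> 5) u v w
                      + wedge3 (\<alpha> 2) (\<alpha> 4) (\<alpha> 6) u v w
                      + wedge3 (\<alpha> 3) (\<alpha> 5) (\<alpha> 6) u v w)"

definition pullback3 ::
  "('v \<Rightarrow> 'v) \<Rightarrow> ('v \<Rightarrow> 'v \<Rightarrow> 'v \<Rightarrow> real) \<Rightarrow> 'v \<Rightarrow> 'v \<Rightarrow> 'v \<Rightarrow> real" where
  "pullback3 g \<omega> = (\<lambda>u v w. \<omega> (g u) (g v) (g w))"

definition GL :: "('v::real_vector \<Rightarrow> 'v) set" where
  "GL = {g. linear g \<and> bij g}"

text \<open>The orbit \<open>U\<^sub>0\<close>, relative to the basis \<open>\<alpha> 1, \<dots>, \<alpha> 6\<close> of the dual used to write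
  \<open>\<omega>\<^sub>0\<close>.\<close>

definition U0 :: "(nat \<Rightarrow> 'v::real_vector \<Rightarrow> real) \<Rightarrow> ('v \<Rightarrow> 'v \<Rightarrow> 'v \<Rightarrow> real) set" where
  "U0 \<alpha> = (\<lambda>g. pullback3 g (omega0 \<alpha>)) ` GL"

definition tangent_structure :: "('v::real_vector \<Rightarrow> 'v) \<Rightarrow> bool" where
  "tangent_structure F \<longleftrightarrow> linear F \<and> (\<forall>v. F (F v) = 0) \<and> range F = {v. F v = 0}"

definition compatible3 :: "('v \<Rightarrow> 'v \<Rightarrow> 'v \<Rightarrow> real) \<Rightarrow> ('v \<Rightarrow> 'v) \<Rightarrow> bool" where
  "compatible3 \<omega> F \<longleftrightarrow>
     (\<forall>v1 v2 v3. \<omega> (F v1) v2 v3 = \<omega> v1 (F v2) v3 \<and> \<omega> v1 (F v2) v3 = \<omega> v1 v2 (F v3))"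

lemma wedge3_alt3_forms:
  assumes "linear a" "linear b" "linear c"
  shows "wedge3 a b c \<in> alt3_forms"
proof -
  note lin = assms[THEN linear_add] assms[THEN linear_scale]
  show ?thesis
    unfolding alt3_forms_def wedge3_def det_3 vector_3
    by (auto intro!: linearI simp: lin algebra_simps)
qed

lemma U0_subset_alt3_forms:
  assumes "is_dual_basis {1..6} \<alpha>"
  shows "U0 \<alpha> \<subseteq> alt3_forms"
proof
  fix \<omega> assume "\<omega> \<in> U0 \<alpha>"
  then obtain g where g: "linear g" and \<omega>: "\<omega> = pullback3 g (omega0 \<alpha>)"
    by (auto simp: U0_def GL_def)
  have lin: "linear (\<alpha> i)" if "i \<in> {1..6}" for i
    using assms that by (auto simp: is_dual_basis_def)
  have lg: "linear (\<lambda>v. \<alpha> i (g v))" if "i \<in> {1..6}" for i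
    using linear_compose[OF g lin[OF that]] by (simp add: o_def)
  have eq: "\<omega> = (\<lambda>u v w.
      wedge3 (\<lambda>v. \<alpha> 1 (g v)) (\<lambda>v. \<alpha> 4 (g v)) (\<lambda>v. \<alpha> 5 (g v)) u v w
    + wedge3 (\<lambda>v. \<alpha> 2 (g v)) (\<lambda>v. \<alpha> 4 (g v)) (\<lambda>v. \<alpha> 6 (g v)) u v w
    + wedge3 (\<lambda>v. \<alpha> 3 (g v)) (\<lambda>v. \<alpha> 5 (g v)) (\<lambda>v. \<alpha> 6 (g v)) u v w)"
    by (simp add: \<omega> pullback3_def omega0_def wedge3_def)
  have w: "wedge3 (\<lambda>v. \<alpha> i (g v)) (\<lambda>v. \<alpha> j (g v)) (\<lambda>v. \<alpha> k (g v)) \<in> alt3_forms"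
    if "i \<in> {1..6}" "j \<in> {1..6}" "k \<in> {1..6}" for i j k
    by (intro wedge3_alt3_forms lg that)
  show "\<omega> \<in> alt3_forms"
    using w[of 1 4 5] w[of 2 4 6] w[of 3 5 6] unfolding eq alt3_forms_def
    by (auto intro!: linear_compose_add)
qed

end

theory Submission
  imports Defs
begin

text \<open>
  Let \<open>e\<^sub>1, \<dots>, e\<^sub>6\<close> be the basis of \<open>V\<close> dual to the functionals \<open>\<beta>\<^sub>i = \<alpha>\<^sub>i \<circ> g\<close> in which
  \<open>\<omega>\<close> has the normal form, \<open>L = span {e\<^sub>1, e\<^sub>2, e\<^sub>3}\<close> and \<open>W = V / L\<close>. Contraction with \<open>\<omega>\<close>
  identifies \<open>L\<close> with \<open>\<Lambda>\<^sup>2W\<^sup>*\<close>, and \<open>F\<close> sends \<open>w\<close> to the contraction of \<open>w\<close> with the volume form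
  \<open>\<beta>\<^sub>4 \<and> \<beta>\<^sub>5 \<and> \<beta>\<^sub>6\<close>; then \<open>\<omega>(F u, v, w)\<close> is that volume form, so it is alternating and \<open>F\<close> is
  compatible. Conversely, the compatibility equations are linear in \<open>G\<close>, and evaluated on the basis
  they already force \<open>G = a I + c F\<close>. Finally \<open>G\<^sup>2 = 0\<close> gives \<open>a = 0\<close>, and \<open>G \<noteq> 0\<close> gives \<open>c \<noteq> 0\<close>.
\<close>

text \<open>Induction on \<open>I\<close>: a vector killed by the old functionals but not by
  \<open>\<alpha> k\<close> is normalised to \<open>x\<close>, and each old dual vector is then
  corrected by a multiple of \<open>x\<close>.\<close>

lemma independent_functionals_dual_vectors:
  fixes \<alpha> :: "'i \<Rightarrow> 'v::real_vector \<Rightarrow> real"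
  assumes "finite I" "\<And>i. i \<in> I \<Longrightarrow> linear (\<alpha> i)"
    and "\<And>c. \<forall>v. (\<Sum>i\<in>I. c i * \<alpha> i v) = 0 \<Longrightarrow> \<forall>i\<in>I. c i = 0"
  shows "\<exists>e. \<forall>i\<in>I. \<forall>j\<in>I. \<alpha> i (e j) = (if i = j then 1 else 0)"
  using assms
proof (induction I rule: finite_induct)
  case empty
  then show ?case by simp
next
  case (insert k I)
  have indep: "\<forall>i\<in>I. c i = 0" if c: "\<forall>v. (\<Sum>i\<in>I. c i * \<alpha> i v) = 0" for c
  proof -
    have "(\<Sum>i\<in>insert k I. (c(k := 0)) i * \<alpha> i v) = (\<Sum>i\<in>I. c i * \<alpha> i v)" for v
      using insert.hyps by (auto intro!: sum.cong)
    then have "\<forall>i\<in>insert k I. (c(k := 0)) i = 0"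
      using c insert.prems(2)[of "c(k := 0)"] by simp
    then show ?thesis
      using insert.hyps by (metis fun_upd_other insertCI)
  qed
  obtain e where e: "\<forall>i\<in>I. \<forall>j\<in>I. \<alpha> i (e j) = (if i = j then 1 else 0)"
    using insert.IH insert.prems(1) indep by (metis insertCI)
  \<comment> \<open>\<open>h\<close> is \<open>\<alpha> k\<close> after the projection onto the
    common kernel of the old functionals along the span of the \<open>e j\<close>; if it vanished,
    \<open>\<alpha> k\<close> would depend on them.\<close>
  define h where "h v = \<alpha> k v - (\<Sum>j\<in>I. \<alpha> j v * \<alpha> k (e j))" for v
  have "\<exists>v. h v \<noteq> 0"
  proof (rule ccontr)
    assume "\<nexists>v. h v \<noteq> 0"
    moreover define c where "c i = (if i = k then 1 else - \<alpha> k (e i))" for i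
    moreover have "(\<Sum>i\<in>insert k I. c i * \<alpha> i v) = h v" for v
    proof -
      have "(\<Sum>i\<in>I. c i * \<alpha> i v) = (\<Sum>i\<in>I. - (\<alpha> i v * \<alpha> k (e i)))"
        using insert.hyps by (intro sum.cong) (auto simp: c_def)
      then show ?thesis
        using insert.hyps by (simp add: h_def sum_negf) (simp add: c_def)
    qed
    ultimately have "c k = 0"
      using insert.prems(2)[of c] by simp
    then show False by (simp add: c_def)
  qed
  then obtain v where v: "h v \<noteq> 0" by blast
  define x where "x = (1 / h v) *\<^sub>R (v - (\<Sum>j\<in>I. \<alpha> j v *\<^sub>R e j))"
  have lin: "linear (\<alpha> i)" if "i \<in> insert k I" for i
    using insert.prems(1) that by blast
  have ax: "\<alpha> i x = (1 / h v) * (\<alpha> i v - (\<Sum>j\<in>I. \<alpha> j v * \<alpha> i (e j)))" if "i \<in> insert k I" for i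
    using lin[OF that] by (simp add: x_def linear_scale linear_diff linear_sum
        diff_divide_distrib flip: sum_divide_distrib)
  have xk: "\<alpha> k x = 1"
    using v ax[of k] by (simp add: h_def)
  have xi: "\<alpha> i x = 0" if i: "i \<in> I" for i
  proof -
    have "(\<Sum>j\<in>I. \<alpha> j v * \<alpha> i (e j)) = (\<Sum>j\<in>I. if i = j then \<alpha> j v else 0)"
      using e i by (intro sum.cong) auto
    then show ?thesis
      using ax[of i] i insert.hyps by simp
  qed
  show ?case
  proof (intro exI ballI)
    fix i j assume ij: "i \<in> insert k I" "j \<in> insert k I"
    show "\<alpha> i ((\<lambda>j. if j = k then x else e j - \<alpha> k (e j) *\<^sub>R x) j) = (if i = j then 1 else 0)"
      using ij e xk xi insert.hyps(2) lin[OF ij(1)] by (auto simp: linear_diff linear_scale)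
  qed
qed

lemma linear_functional_nonzero:
  fixes v :: "'v::real_vector"
  assumes "v \<noteq> 0"
  shows "\<exists>f. linear f \<and> f v = (1::real)"
proof -
  have "independent {v}"
    using assms by simp
  from linear_independent_extend[OF this, of "\<lambda>_. 1::real"] show ?thesis
    by auto
qed

text \<open>Some linear functional takes the value 1 on a nonzero vector, and it is a combination of
  the \<open>\<alpha> i\<close>.\<close>

lemma dual_basis_separates:
  assumes "is_dual_basis I \<alpha>" "\<And>i. i \<in> I \<Longrightarrow> \<alpha> i v = 0"
  shows "v = 0"
proof (rule ccontr)
  assume "v \<noteq> 0"
  then obtain f where "linear f" and fv: "f v = (1::real)"
    using linear_functional_nonzero by blast
  then obtain c where "\<forall>v. f v = (\<Sum>i\<in>I. c i * \<alpha> i v)"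
    using assms(1) unfolding is_dual_basis_def by metis
  then show False
    using fv assms(2) by simp
qed

lemma atLeastAtMost_1_6: "{1..6::nat} = {1, 2, 3, 4, 5, 6}"
  by auto

text \<open>A basis with its dual basis; \<open>separates\<close> stands in for spanning, so that
  vector identities reduce to six scalar ones.\<close>

locale coordinates6 =
  fixes \<beta> :: "nat \<Rightarrow> 'v::real_vector \<Rightarrow> real" and e :: "nat \<Rightarrow> 'v"
  assumes lin: "i \<in> {1..6} \<Longrightarrow> linear (\<beta> i)"
    and dual: "i \<in> {1..6} \<Longrightarrow> j \<in> {1..6} \<Longrightarrow> \<beta> i (e j) = (if i = j then 1 else 0)"
    and separates: "(\<And>i. i \<in> {1..6} \<Longrightarrow> \<beta> i v = 0) \<Longrightarrow> v = 0"
begin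

lemma eqI:
  assumes "\<beta> 1 v = \<beta> 1 w" "\<beta> 2 v = \<beta> 2 w" "\<beta> 3 v = \<beta> 3 w"
    "\<beta> 4 v = \<beta> 4 w" "\<beta> 5 v = \<beta> 5 w" "\<beta> 6 v = \<beta> 6 w"
  shows "v = w"
proof -
  have "\<beta> i (v - w) = 0" if "i \<in> {1..6}" for i
    using assms lin[OF that] that[unfolded atLeastAtMost_1_6] by (auto simp: linear_diff)
  then show ?thesis
    using separates[of "v - w"] by simp
qed

lemmas coordinate_linear =
  linear_add[OF lin] linear_scale[OF lin] linear_diff[OF lin] linear_0[OF lin] linear_neg[OF lin]

lemmas coordinate_simps = coordinate_linear dual

lemma expansion:
  "v = \<beta> 1 v *\<^sub>R e 1 + \<beta> 2 v *\<^sub>R e 2 + \<beta> 3 v *\<^sub>R e 3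
     + \<beta> 4 v *\<^sub>R e 4 + \<beta> 5 v *\<^sub>R e 5 + \<beta> 6 v *\<^sub>R e 6"
  by (rule eqI) (simp_all add: coordinate_simps del: One_nat_def)

text \<open>Order and signs come from expanding
  \<open>\<beta> 4 \<and> \<beta> 5 \<and> \<beta> 6\<close> along its first argument:
  \<open>e 1\<close>, \<open>e 2\<close>, \<open>e 3\<close> contract \<open>omega0 \<beta>\<close>
  to the wedges of \<open>\<beta>\<close> with indices 45, 46, 56.\<close>

definition F :: "'v \<Rightarrow> 'v" where
  "F v = \<beta> 6 v *\<^sub>R e 1 - \<beta> 5 v *\<^sub>R e 2 + \<beta> 4 v *\<^sub>R e 3"

lemma coordinate_F:
  "\<beta> 1 (F v) = \<beta> 6 v" "\<beta> 2 (F v) = - \<beta> 5 v" "\<beta> 3 (F v) = \<beta> 4 v"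
  "\<beta> 4 (F v) = 0" "\<beta> 5 (F v) = 0" "\<beta> 6 (F v) = 0"
  by (simp_all add: F_def coordinate_simps del: One_nat_def)

lemma tangent_structure_F: "tangent_structure F"
  unfolding tangent_structure_def
proof (intro conjI allI)
  show "linear F"
    by (rule linearI; rule eqI)
      (simp_all add: coordinate_F coordinate_linear del: One_nat_def)
  show FF: "F (F v) = 0" for v
    by (rule eqI) (simp_all add: coordinate_F coordinate_linear del: One_nat_def)
  show "range F = {v. F v = 0}"
  proof (intro equalityI subsetI)
    fix v assume "v \<in> {v. F v = 0}"
    then have Fv: "F v = 0" by simp
    \<comment> \<open>\<open>F v = 0\<close> makes the last three coordinates of \<open>v\<close>
      vanish, and \<open>F\<close> sends \<open>e 6\<close>, \<open>- e 5\<close>,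
      \<open>e 4\<close> to \<open>e 1\<close>, \<open>e 2\<close>, \<open>e 3\<close>.\<close>
    have "v = F (\<beta> 1 v *\<^sub>R e 6 - \<beta> 2 v *\<^sub>R e 5 + \<beta> 3 v *\<^sub>R e 4)"
      using coordinate_F[of v] unfolding Fv
      by (intro eqI)
        (simp_all add: coordinate_F coordinate_simps del: One_nat_def)
    then show "v \<in> range F" by blast
  qed (use FF in auto)
qed

lemmas omega0_expand = omega0_def wedge3_def det_3 vector_3

lemma compatible3_F: "compatible3 (omega0 \<beta>) F"
  unfolding compatible3_def omega0_expand coordinate_F
  by (simp add: algebra_simps del: One_nat_def)

lemma compatible3_coordinates:
  assumes "compatible3 (omega0 \<beta>) G"
  shows "\<exists>a c. \<forall>i\<in>{1..6}. G (e i) = a *\<^sub>R e i + c *\<^sub>R F (e i)"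
proof -
  note C = assms[unfolded compatible3_def omega0_expand, rule_format]
  note C2 = C[THEN conjunct2]
  define a where "a = \<beta> 4 (G (e 4))"
  define c where "c = \<beta> 1 (G (e 6))"
  \<comment> \<open>The form vanishes on two vectors among \<open>e 1\<close>, \<open>e 2\<close>,
    \<open>e 3\<close>, so the side with \<open>G\<close> on the third argument is zero.\<close>
  have W_of_L:
    "\<beta> 4 (G (e 1)) = 0 \<and> \<beta> 5 (G (e 1)) = 0 \<and> \<beta> 6 (G (e 1)) = 0 \<and>
     \<beta> 4 (G (e 2)) = 0 \<and> \<beta> 5 (G (e 2)) = 0 \<and> \<beta> 6 (G (e 2)) = 0 \<and>
     \<beta> 4 (G (e 3)) = 0 \<and> \<beta> 5 (G (e 3)) = 0 \<and> \<beta> 6 (G (e 3)) = 0"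
    using
      C[of "e 1" "e 2" "e 4"] C[of "e 1" "e 2" "e 5"] C[of "e 1" "e 2" "e 6"]
      C[of "e 1" "e 3" "e 4"] C[of "e 1" "e 3" "e 5"] C[of "e 1" "e 3" "e 6"]
      C[of "e 2" "e 3" "e 4"] C[of "e 2" "e 3" "e 5"] C[of "e 2" "e 3" "e 6"]
    by (simp add: dual del: One_nat_def)
  \<comment> \<open>These index triples are not terms of \<open>omega0\<close>: one of the three
    sides is zero, the other two are single coordinates up to sign.\<close>
  have off_diagonal:
    "\<beta> 2 (G (e 1)) = 0 \<and> \<beta> 3 (G (e 1)) = 0 \<and> \<beta> 1 (G (e 2)) = 0 \<and>
     \<beta> 3 (G (e 2)) = 0 \<and> \<beta> 1 (G (e 3)) = 0 \<and> \<beta> 2 (G (e 3)) = 0 \<and>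
     \<beta> 5 (G (e 4)) = 0 \<and> \<beta> 6 (G (e 4)) = 0 \<and> \<beta> 4 (G (e 5)) = 0 \<and>
     \<beta> 6 (G (e 5)) = 0 \<and> \<beta> 4 (G (e 6)) = 0 \<and> \<beta> 5 (G (e 6)) = 0"
    using
      C[of "e 1" "e 4" "e 6"] C[of "e 1" "e 5" "e 6"] C[of "e 2" "e 4" "e 5"]
      C[of "e 2" "e 5" "e 6"] C[of "e 3" "e 4" "e 5"] C[of "e 3" "e 4" "e 6"]
    by (simp add: dual del: One_nat_def)
  \<comment> \<open>These triples are the terms of \<open>omega0\<close>; each equates three
    diagonal entries, and shared indices link them all.\<close>
  have diagonal:
    "\<beta> 1 (G (e 1)) = a \<and> \<beta> 2 (G (e 2)) = a \<and> \<beta> 3 (G (e 3)) = a \<and>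
     \<beta> 4 (G (e 4)) = a \<and> \<beta> 5 (G (e 5)) = a \<and> \<beta> 6 (G (e 6)) = a"
    using
      C[of "e 1" "e 4" "e 5"] C[of "e 2" "e 4" "e 6"] C[of "e 3" "e 5" "e 6"]
    by (simp add: a_def dual del: One_nat_def)
  \<comment> \<open>A repeated argument gives
    \<open>\<omega>(u, G u, v) = \<omega>(u, u, G v) = 0\<close>.\<close>
  have L_of_W_0:
    "\<beta> 1 (G (e 4)) = 0 \<and> \<beta> 2 (G (e 4)) = 0 \<and> \<beta> 1 (G (e 5)) = 0 \<and>
     \<beta> 3 (G (e 5)) = 0 \<and> \<beta> 2 (G (e 6)) = 0 \<and> \<beta> 3 (G (e 6)) = 0"
    using
      C2[of "e 4" "e 4" "e 5"] C2[of "e 4" "e 4" "e 6"] C2[of "e 5" "e 5" "e 4"]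
      C2[of "e 5" "e 5" "e 6"] C2[of "e 6" "e 6" "e 4"] C2[of "e 6" "e 6" "e 5"]
    by (simp add: dual del: One_nat_def)
  \<comment> \<open>The one remaining triple leaves a single free parameter, the coefficient of
    \<open>F\<close>.\<close>
  have L_of_W_c:
    "\<beta> 3 (G (e 4)) = c \<and> \<beta> 2 (G (e 5)) = - c \<and> \<beta> 1 (G (e 6)) = c"
    using C[of "e 4" "e 5" "e 6"]
    by (simp add: c_def dual del: One_nat_def)
  have "G (e i) = a *\<^sub>R e i + c *\<^sub>R F (e i)" if "i \<in> {1..6}" for i
    using that unfolding atLeastAtMost_1_6 insert_iff empty_iff
    by (elim disjE FalseE; intro eqI; hypsubst)
      (simp_all add: coordinate_simps coordinate_F W_of_L off_diagonal diagonal
        L_of_W_0 L_of_W_c del: One_nat_def)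
  then show ?thesis
    by blast
qed

lemma compatible3_linear_imp:
  assumes "linear G" "compatible3 (omega0 \<beta>) G"
  shows "\<exists>a c. \<forall>v. G v = a *\<^sub>R v + c *\<^sub>R F v"
proof -
  obtain a c where G: "\<And>i. i \<in> {1..6} \<Longrightarrow> G (e i) = a *\<^sub>R e i + c *\<^sub>R F (e i)"
    using compatible3_coordinates[OF assms(2)] by blast
  have "G v = a *\<^sub>R v + c *\<^sub>R F v" for v
  proof -
    have "G v = \<beta> 1 v *\<^sub>R G (e 1) + \<beta> 2 v *\<^sub>R G (e 2) + \<beta> 3 v *\<^sub>R G (e 3)
        + \<beta> 4 v *\<^sub>R G (e 4) + \<beta> 5 v *\<^sub>R G (e 5) + \<beta> 6 v *\<^sub>R G (e 6)"
      by (subst expansion[of v]) (simp only: linear_add[OF assms(1)] linear_scale[OF assms(1)])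
    then show ?thesis
      by (intro eqI) (simp_all add: G coordinate_simps coordinate_F del: One_nat_def)
  qed
  then show ?thesis
    by blast
qed

lemma tangent_structure_unique:
  assumes "tangent_structure G" "compatible3 (omega0 \<beta>) G"
  shows "\<exists>c. c \<noteq> 0 \<and> G = (\<lambda>v. c *\<^sub>R F v)"
proof -
  have linG: "linear G" and GG: "\<And>v. G (G v) = 0" and ker: "range G = {v. G v = 0}"
    using assms(1) by (auto simp: tangent_structure_def)
  obtain a c where G: "\<And>v. G v = a *\<^sub>R v + c *\<^sub>R F v"
    using compatible3_linear_imp[OF linG assms(2)] by blast
  \<comment> \<open>\<open>F\<close> kills \<open>e 1\<close>, so \<open>e 1\<close> is an
    eigenvector of \<open>G\<close> with eigenvalue \<open>a\<close>.\<close>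
  have "\<beta> 1 (G (G (e 1))) = a * a"
    by (simp add: G coordinate_simps coordinate_F del: One_nat_def)
  then have "a = 0"
    by (simp add: GG coordinate_simps del: One_nat_def)
  moreover have "c \<noteq> 0"
  proof
    assume "c = 0"
    \<comment> \<open>The zero map has kernel \<open>V\<close> but range \<open>{0}\<close>.\<close>
    then have "G v = 0" for v
      using \<open>a = 0\<close> G by simp
    then have "e 1 = 0"
      using ker by auto
    then have "\<beta> 1 (e 1) = 0"
      by (simp add: coordinate_linear del: One_nat_def)
    then show False
      by (simp add: dual del: One_nat_def)
  qed
  ultimately show ?thesis
    using G by auto
qed

end

theorem proposition3p8:
  fixes \<alpha> :: "nat \<Rightarrow> 'v::real_vector \<Rightarrow> real"
    and \<omega> :: "'v \<Rightarrow> 'v \<Rightarrow> 'v \<Rightarrow> real"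
  assumes "dim (UNIV :: 'v set) = 6"
    and "is_dual_basis {1..6} \<alpha>"
    and "\<omega> \<in> U0 \<alpha>"
  shows "\<exists>F. tangent_structure F \<and> compatible3 \<omega> F \<and>
           (\<forall>G. tangent_structure G \<and> compatible3 \<omega> G \<longrightarrow>
              (\<exists>c::real. c \<noteq> 0 \<and> G = (\<lambda>v. c *\<^sub>R F v)))"
proof -
  note basis = assms(2)[unfolded is_dual_basis_def]
  obtain g where g: "linear g" "bij g" and \<omega>: "\<omega> = pullback3 g (omega0 \<alpha>)"
    using assms(3) by (auto simp: U0_def GL_def)
  obtain e where e: "\<forall>i\<in>{1..6}. \<forall>j\<in>{1..6}. \<alpha> i (e j) = (if i = j then 1 else 0)"
    using independent_functionals_dual_vectors[of "{1..6}" \<alpha>] basis by blast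
  define \<beta> where "\<beta> i v = \<alpha> i (g v)" for i v
  interpret coordinates6 \<beta> "\<lambda>j. inv g (e j)"
  proof (rule coordinates6.intro)
    show "linear (\<beta> i)" if "i \<in> {1..6}" for i
      using linear_compose[OF g(1), of "\<alpha> i"] basis that by (simp add: \<beta>_def[abs_def] o_def)
    show "\<beta> i (inv g (e j)) = (if i = j then 1 else 0)" if "i \<in> {1..6}" "j \<in> {1..6}" for i j
      using e that g(2) by (simp add: \<beta>_def bij_is_surj surj_f_inv_f)
    show "v = 0" if "\<And>i. i \<in> {1..6} \<Longrightarrow> \<beta> i v = 0" for v
    proof -
      have "g v = g 0"
        using dual_basis_separates[OF assms(2), of "g v"] that linear_0[OF g(1)]
        by (simp add: \<beta>_def)
      then show ?thesis
        using g(2) by (simp add: bij_is_inj inj_eq)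
    qed
  qed
  have "\<omega> = omega0 \<beta>"
    by (simp add: \<omega> pullback3_def omega0_def wedge3_def \<beta>_def fun_eq_iff)
  then show ?thesis
    using tangent_structure_F compatible3_F tangent_structure_unique by blast
qed

end
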